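(* Let $k$ be a field and let $M$ be a monomial ideal of $S=k[x_1,\ldots,x_n]$. Then $\operatorname{pd}(S/M)\leq n$.
   Context: A monomial ideal is an ideal generated by monomials. The projective dimension is $\operatorname{pd}(S/M)=\max\{i : b_i(S/M)\neq 0\}$, where $b_i(S/M)=\operatorname{rank}(F_i)$ and $\cdots\to F_i\to F_{i-1}\to\cdots\to F_0\to S/M\to 0$ is a minimal (multigraded) free resolution of $S/M$ over $S$, that is, one in which no differential matrix has an invertible entry. Thus $\operatorname{pd}(S/M)\leq n$ means that $b_i(S/M)=0$ for all $i>n$. *)

theory Defs
  imports
    "HOL-Library.Poly_Mapping"
    "HOL-Library.Extended_Nat"
    "HOL-Library.Cardinality"
    "Jordan_Normal_Form.Matrix_Kernel"
begin

text \<open>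
  The polynomial ring over the field \<open>'k\<close> in the variables indexed by \<open>'n\<close>. For a finite type
  \<open>'n\<close> this is \<open>k[x\<^sub>1,\<dots>,x\<^sub>n]\<close> with \<open>n = CARD('n)\<close>; the monomial with exponent vector \<open>t\<close> is
  \<open>Poly_Mapping.single t 1\<close>.
\<close>

type_synonym ('n, 'k) polynomials = "('n \<Rightarrow>\<^sub>0 nat) \<Rightarrow>\<^sub>0 'k"

definition ideal_generated_by ::
    "('n, 'k::field) polynomials set \<Rightarrow> ('n, 'k) polynomials set" where
  "ideal_generated_by B = Modules.module.span (*) B"

lemma module_polynomials:
  "Modules.module ((*) :: ('n, 'k::field) polynomials \<Rightarrow> _ \<Rightarrow> _)"
  by unfold_locales (simp_all add: algebra_simps)

definition monomial_ideal :: "('n, 'k::field) polynomials set \<Rightarrow> bool" where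
  "monomial_ideal M \<longleftrightarrow>
     (\<exists>T. M = ideal_generated_by ((\<lambda>t. Poly_Mapping.single t 1) ` T))"

text \<open>
  Multidegrees live in \<open>\<int>\<^sup>n\<close>, so that arbitrary shifts are allowed. The zero polynomial is homogeneous
  of every multidegree; it is the only one when some component of \<open>a\<close> is negative.
\<close>

definition homogeneous :: "('n \<Rightarrow> int) \<Rightarrow> ('n, 'k::field) polynomials \<Rightarrow> bool" where
  "homogeneous a p \<longleftrightarrow> (\<forall>t\<in>Poly_Mapping.keys p. \<forall>x. int (Poly_Mapping.lookup t x) = a x)"

text \<open>
  A multigraded free resolution
  \<open>\<cdots> \<rightarrow> F\<^sub>2 \<rightarrow> F\<^sub>1 \<rightarrow> F\<^sub>0 \<rightarrow> S/M \<rightarrow> 0\<close> by free modules of finite rank, in coordinates: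
  \<open>F\<^sub>i\<close> is \<open>carrier_vec (b i)\<close>, its \<open>j\<close>-th basis vector has multidegree \<open>\<delta> i j\<close>, and
  the matrix of the differential \<open>F\<^bsub>i+1\<^esub> \<rightarrow> F\<^sub>i\<close> is \<open>d i\<close>. The augmentation \<open>F\<^sub>0 \<rightarrow> S/M\<close> sends \<open>v\<close> to
  the class of \<open>\<epsilon> \<bullet> v\<close>, the entries of \<open>\<epsilon>\<close> being homogeneous representatives of the images of
  the basis vectors; surjectivity onto \<open>S/M\<close> and the kernel are expressed modulo \<open>M\<close>.
\<close>

definition multigraded_free_resolution ::
    "('n, 'k::field) polynomials set \<Rightarrow> (nat \<Rightarrow> nat) \<Rightarrow> (nat \<Rightarrow> nat \<Rightarrow> 'n \<Rightarrow> int) \<Rightarrow>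
     ('n, 'k) polynomials vec \<Rightarrow> (nat \<Rightarrow> ('n, 'k) polynomials mat) \<Rightarrow> bool" where
  "multigraded_free_resolution M b \<delta> \<epsilon> d \<longleftrightarrow>
     \<epsilon> \<in> carrier_vec (b 0) \<and>
     (\<forall>i. d i \<in> carrier_mat (b i) (b (Suc i))) \<and>
     (\<forall>j<b 0. homogeneous (\<delta> 0 j) (\<epsilon> $ j)) \<and>
     (\<forall>i. \<forall>j<b i. \<forall>l<b (Suc i). homogeneous (\<lambda>x. \<delta> (Suc i) l x - \<delta> i j x) (d i $$ (j, l))) \<and>
     (\<forall>s. \<exists>v\<in>carrier_vec (b 0). \<epsilon> \<bullet> v - s \<in> M) \<and>
     {v \<in> carrier_vec (b 0). \<epsilon> \<bullet> v \<in> M} = (\<lambda>w. d 0 *\<^sub>v w) ` carrier_vec (b (Suc 0)) \<and>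
     (\<forall>i. mat_kernel (d i) = (\<lambda>w. d (Suc i) *\<^sub>v w) ` carrier_vec (b (Suc (Suc i))))"

text \<open>The augmentation is not a differential, so the condition on the entries does not apply to it.\<close>

definition minimal_free_resolution ::
    "('n, 'k::field) polynomials set \<Rightarrow> (nat \<Rightarrow> nat) \<Rightarrow> (nat \<Rightarrow> nat \<Rightarrow> 'n \<Rightarrow> int) \<Rightarrow>
     ('n, 'k) polynomials vec \<Rightarrow> (nat \<Rightarrow> ('n, 'k) polynomials mat) \<Rightarrow> bool" where
  "minimal_free_resolution M b \<delta> \<epsilon> d \<longleftrightarrow>
     multigraded_free_resolution M b \<delta> \<epsilon> d \<and>
     (\<forall>i. \<forall>j<b i. \<forall>l<b (Suc i). \<not> d i $$ (j, l) dvd 1)"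

text \<open>
  The projective dimension of \<open>S/M\<close>. The ranks \<open>b i\<close> do not depend on the choice of the minimal
  free resolution; rather than fixing a choice, the supremum is taken over the homological degrees in
  which some minimal resolution is nonzero. For \<open>M = S\<close> there is no such degree, and the value is \<open>0\<close>.
\<close>

definition proj_dim_quotient :: "('n, 'k::field) polynomials set \<Rightarrow> enat" where
  "proj_dim_quotient M =
     (SUP i\<in>{i. \<exists>b \<delta> \<epsilon> d. minimal_free_resolution M b \<delta> \<epsilon> d \<and> b i \<noteq> 0}. enat i)"

end

theory Submission
  imports Defs
begin

text \<open>
  The variables form a regular sequence in \<open>S\<close>, so reducing a resolution \<open>F\<close> modulo one more
  variable shifts the vanishing range of its homology by at most one: \<open>F\<close> modulo the ideal generated by
  a set \<open>A\<close> of variables is exact in all homological degrees above \<open>card A\<close>. For the set of all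
  variables the differentials of a minimal resolution become zero, hence \<open>F\<^sub>i\<close> coincides with its
  submodule of elements without constant terms as soon as \<open>i > n\<close>, which forces \<open>F\<^sub>i = 0\<close>.
\<close>

text \<open>This is the ideal generated by the variables in \<open>A\<close>: every monomial of
  \<open>p\<close> is divisible by one of them. Membership is thus tested one exponent at a time,
  without writing \<open>p\<close> in terms of generators.\<close>

definition var_ideal :: "'n set \<Rightarrow> ('n, 'k::field) polynomials set" where
  "var_ideal A = {p. \<forall>t\<in>Poly_Mapping.keys p. \<exists>x\<in>A. Poly_Mapping.lookup t x \<noteq> 0}"

abbreviation var :: "'n \<Rightarrow> ('n, 'k::field) polynomials" where
  "var x \<equiv> Poly_Mapping.single (Poly_Mapping.single x (Suc 0)) 1"

lemma var_ideal_empty: "var_ideal {} = {0}"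
  by (auto simp: var_ideal_def)

lemma var_ideal_mono: "A \<subseteq> B \<Longrightarrow> var_ideal A \<subseteq> var_ideal B"
  unfolding var_ideal_def by blast

lemma zero_in_var_ideal: "0 \<in> var_ideal A"
  by (simp add: var_ideal_def)

lemma one_notin_var_ideal: "1 \<notin> var_ideal A"
  by (simp add: var_ideal_def)

lemma var_ideal_add: "p \<in> var_ideal A \<Longrightarrow> q \<in> var_ideal A \<Longrightarrow> p + q \<in> var_ideal A"
  unfolding var_ideal_def using Poly_Mapping.keys_add[of p q] by blast

lemma var_ideal_mult_left:
  assumes "q \<in> var_ideal A"
  shows "p * q \<in> var_ideal A"
  unfolding var_ideal_def
proof safe
  fix t assume "t \<in> Poly_Mapping.keys (p * q)"
  then obtain r s where t: "t = r + s" "s \<in> Poly_Mapping.keys q"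
    using keys_mult[of p q] by blast
  then obtain x where "x \<in> A" "Poly_Mapping.lookup s x \<noteq> 0"
    using assms by (auto simp: var_ideal_def)
  then show "\<exists>x\<in>A. Poly_Mapping.lookup t x \<noteq> 0"
    unfolding t lookup_add by auto
qed

lemma var_ideal_mult_right: "p \<in> var_ideal A \<Longrightarrow> p * q \<in> var_ideal A"
  using var_ideal_mult_left[of p A q] by (simp add: mult.commute)

lemma var_ideal_diff:
  assumes "p \<in> var_ideal A" "q \<in> var_ideal A"
  shows "p - q \<in> var_ideal A"
  using var_ideal_add[OF assms(1) var_ideal_mult_left[OF assms(2), of "-1"]] by simp

lemma var_ideal_sum: "(\<And>i. i \<in> I \<Longrightarrow> f i \<in> var_ideal A) \<Longrightarrow> sum f I \<in> var_ideal A"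
  by (induction I rule: infinite_finite_induct) (auto intro: zero_in_var_ideal var_ideal_add)

lemma var_in_var_ideal: "x \<in> A \<Longrightarrow> var x \<in> var_ideal A"
  by (auto simp: var_ideal_def intro!: bexI[of _ x])

section \<open>Variables as a regular sequence\<close>

lemma lookup_monomial_mult:
  fixes p :: "('n, 'k::field) polynomials"
  shows "Poly_Mapping.lookup (Poly_Mapping.single s c * p) (s + t) = c * Poly_Mapping.lookup p t"
proof -
  have "Sum_any (\<lambda>q. Poly_Mapping.lookup p q when s + t = s + q) = Poly_Mapping.lookup p t"
    by simp
  moreover have "Poly_Mapping.lookup (Poly_Mapping.single s c) l = (c when l = s)" for l
    by (simp add: lookup_single eq_commute)
  ultimately show ?thesis
    by (simp add: lookup_mult when_mult)
qed

lemma sum_monomials: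
  "(\<Sum>t\<in>Poly_Mapping.keys p. Poly_Mapping.single t (Poly_Mapping.lookup p t)) = p"
  by (intro poly_mapping_eqI)
    (simp add: lookup_sum lookup_single when_def in_keys_iff sum.delta)

text \<open>Multiplying by \<open>var x\<close> shifts the exponents injectively and changes only
  the component at \<open>x\<close>. As \<open>x\<close> is outside \<open>A\<close>, a variable of
  \<open>A\<close> dividing the shifted monomial divides the original one.\<close>

lemma var_regular_mod_var_ideal:
  assumes "x \<notin> A" "var x * p \<in> var_ideal A"
  shows "p \<in> var_ideal A"
  unfolding var_ideal_def
proof safe
  fix t assume "t \<in> Poly_Mapping.keys p"
  then have "Poly_Mapping.single x (Suc 0) + t \<in> Poly_Mapping.keys (var x * p)"
    by (simp add: in_keys_iff lookup_monomial_mult)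
  then obtain y where "y \<in> A" "Poly_Mapping.lookup (Poly_Mapping.single x (Suc 0) + t) y \<noteq> 0"
    using assms(2) by (auto simp: var_ideal_def)
  then show "\<exists>x\<in>A. Poly_Mapping.lookup t x \<noteq> 0"
    using assms(1) by (auto simp: lookup_add lookup_single when_def split: if_splits)
qed

text \<open>The splitting is done monomial by monomial: a monomial of \<open>p\<close> free of
  \<open>x\<close> lies in \<open>var_ideal A\<close> already, and every other one is a multiple of
  \<open>var x\<close>.\<close>

lemma var_ideal_insertE:
  fixes p :: "('n, 'k::field) polynomials"
  assumes "p \<in> var_ideal (insert x A)"
  obtains q where "p - var x * q \<in> var_ideal A"
proof -
  have "\<exists>q. Poly_Mapping.single t c - var x * q \<in> var_ideal A"
    if t: "t \<in> Poly_Mapping.keys p" for t and c :: 'k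
  proof (cases "Poly_Mapping.lookup t x = 0")
    case True
    then have "Poly_Mapping.single t c - var x * 0 \<in> var_ideal A"
      using t assms by (auto simp: var_ideal_def)
    then show ?thesis ..
  next
    case False
    \<comment> \<open>Subtraction of exponents is truncated; adding back is exact because
      \<open>x\<close> occurs in \<open>t\<close>.\<close>
    then have "Poly_Mapping.single x (Suc 0) + (t - Poly_Mapping.single x (Suc 0)) = t"
      by (intro poly_mapping_eqI) (auto simp: lookup_add lookup_minus lookup_single when_def)
    then have "Poly_Mapping.single t c - var x * Poly_Mapping.single (t - Poly_Mapping.single x (Suc 0)) c
        \<in> var_ideal A"
      by (simp add: mult_single zero_in_var_ideal)
    then show ?thesis ..
  qed
  then obtain q where
    q: "Poly_Mapping.single t c - var x * q t c \<in> var_ideal A" if "t \<in> Poly_Mapping.keys p" for t and c :: 'k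
    by metis
  define c where "c = Poly_Mapping.lookup p"
  have "p = (\<Sum>t\<in>Poly_Mapping.keys p. Poly_Mapping.single t (c t))"
    unfolding c_def by (rule sum_monomials[symmetric])
  then have "p - var x * (\<Sum>t\<in>Poly_Mapping.keys p. q t (c t))
      = (\<Sum>t\<in>Poly_Mapping.keys p. Poly_Mapping.single t (c t) - var x * q t (c t))"
    by (simp add: sum_subtractf sum_distrib_left)
  also have "\<dots> \<in> var_ideal A"
    by (intro var_ideal_sum q)
  finally show thesis by (rule that)
qed

text \<open>All monomials of a homogeneous polynomial have the same exponent. If one of them is
  constant, the polynomial is a nonzero constant, hence a unit. The multigrading is essential here:
  \<open>1 + var x\<close> is a nonunit outside the ideal.\<close>

lemma homogeneous_nonunit_in_var_ideal:
  assumes "homogeneous a p" "\<not> p dvd 1"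
  shows "p \<in> var_ideal UNIV"
proof (rule ccontr)
  assume "p \<notin> var_ideal UNIV"
  then obtain t where "t \<in> Poly_Mapping.keys p" "\<And>x. Poly_Mapping.lookup t x = 0"
    by (auto simp: var_ideal_def)
  then have p0: "0 \<in> Poly_Mapping.keys p"
    by (metis poly_mapping_eqI lookup_zero)
  then have "s = 0" if "s \<in> Poly_Mapping.keys p" for s
    using that assms(1) unfolding homogeneous_def
    by (intro poly_mapping_eqI) (metis lookup_zero of_nat_eq_iff)
  with p0 have "Poly_Mapping.keys p = {0}" by auto
  then have "p = Poly_Mapping.single 0 (Poly_Mapping.lookup p 0)"
    using sum_monomials[of p] by simp
  moreover have "Poly_Mapping.lookup p 0 \<noteq> 0"
    using p0 by (simp add: in_keys_iff)
  ultimately have "p * Poly_Mapping.single 0 (inverse (Poly_Mapping.lookup p 0)) = 1"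
    by (metis mult_single add_0 right_inverse single_one)
  with assms(2) show False by (metis dvdI)
qed

section \<open>Reduction of free modules and resolutions modulo variables\<close>

definition var_ideal_vec :: "'n set \<Rightarrow> nat \<Rightarrow> ('n, 'k::field) polynomials vec set" where
  "var_ideal_vec A m = {v \<in> carrier_vec m. \<forall>i<m. v $ i \<in> var_ideal A}"

lemma var_ideal_vec_carrier: "v \<in> var_ideal_vec A m \<Longrightarrow> v \<in> carrier_vec m"
  by (simp add: var_ideal_vec_def)

lemma var_ideal_vec_empty: "var_ideal_vec {} m = {0\<^sub>v m}"
  by (auto simp: var_ideal_vec_def var_ideal_empty)

lemma var_ideal_vec_mono: "A \<subseteq> B \<Longrightarrow> var_ideal_vec A m \<subseteq> var_ideal_vec B m"
  using var_ideal_mono by (fastforce simp: var_ideal_vec_def)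

lemma var_ideal_vec_add:
  "u \<in> var_ideal_vec A m \<Longrightarrow> v \<in> var_ideal_vec A m \<Longrightarrow> u + v \<in> var_ideal_vec A m"
  by (auto simp: var_ideal_vec_def intro!: var_ideal_add)

lemma var_ideal_vec_smult: "v \<in> var_ideal_vec A m \<Longrightarrow> c \<cdot>\<^sub>v v \<in> var_ideal_vec A m"
  by (auto simp: var_ideal_vec_def intro!: var_ideal_mult_left)

lemma var_ideal_vec_uminus: "v \<in> var_ideal_vec A m \<Longrightarrow> - v \<in> var_ideal_vec A m"
  by (auto simp: var_ideal_vec_def intro!: var_ideal_diff[OF zero_in_var_ideal, simplified])

lemma var_smult_in_var_ideal_vec:
  "x \<in> A \<Longrightarrow> v \<in> carrier_vec m \<Longrightarrow> var x \<cdot>\<^sub>v v \<in> var_ideal_vec A m"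
  by (auto simp: var_ideal_vec_def intro!: var_ideal_mult_right var_in_var_ideal)

lemma mult_mat_var_ideal_vec:
  assumes "D \<in> carrier_mat m k" "v \<in> var_ideal_vec A k"
  shows "D *\<^sub>v v \<in> var_ideal_vec A m"
  using assms
  by (auto simp: var_ideal_vec_def scalar_prod_def intro!: var_ideal_sum var_ideal_mult_left)

lemma mult_var_ideal_mat_vec:
  assumes "D \<in> carrier_mat m k" "\<And>i j. i < m \<Longrightarrow> j < k \<Longrightarrow> D $$ (i, j) \<in> var_ideal A"
    "v \<in> carrier_vec k"
  shows "D *\<^sub>v v \<in> var_ideal_vec A m"
  using assms
  by (auto simp: var_ideal_vec_def scalar_prod_def intro!: var_ideal_sum var_ideal_mult_right)

lemma mult_mat_vec_smult:
  fixes D :: "'a::comm_ring_1 mat"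
  shows "D \<in> carrier_mat m k \<Longrightarrow> v \<in> carrier_vec k \<Longrightarrow> D *\<^sub>v (c \<cdot>\<^sub>v v) = c \<cdot>\<^sub>v (D *\<^sub>v v)"
  by (intro eq_vecI) auto

lemma var_regular_mod_var_ideal_vec:
  assumes "x \<notin> A" "v \<in> carrier_vec m" "var x \<cdot>\<^sub>v v \<in> var_ideal_vec A m"
  shows "v \<in> var_ideal_vec A m"
  using assms by (auto simp: var_ideal_vec_def intro: var_regular_mod_var_ideal)

lemma var_ideal_vec_insertE:
  assumes "v \<in> var_ideal_vec (insert x A) m"
  obtains u w where "u \<in> var_ideal_vec A m" "w \<in> carrier_vec m" "v = u + var x \<cdot>\<^sub>v w"
proof -
  have "\<exists>q. v $ i - var x * q \<in> var_ideal A" if "i < m" for i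
  proof -
    have "v $ i \<in> var_ideal (insert x A)"
      using assms that by (simp add: var_ideal_vec_def)
    then show ?thesis
      by (rule var_ideal_insertE) blast
  qed
  then obtain q where q: "v $ i - var x * q i \<in> var_ideal A" if "i < m" for i
    by metis
  show thesis
  proof (rule that)
    show "vec m (\<lambda>i. v $ i - var x * q i) \<in> var_ideal_vec A m"
      using q by (simp add: var_ideal_vec_def)
    show "vec m q \<in> carrier_vec m"
      by simp
    show "v = vec m (\<lambda>i. v $ i - var x * q i) + var x \<cdot>\<^sub>v vec m q"
      using assms by (auto simp: var_ideal_vec_def)
  qed
qed

text \<open>Induction on \<open>A\<close>, following the long exact homology sequence of
  multiplication by \<open>x\<close> on the complex modulo \<open>A\<close>. Vanishing after adding
  \<open>x\<close> needs vanishing modulo \<open>A\<close> in the same degree and in the one below,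
  so each variable costs one degree.\<close>

lemma exact_mod_var_ideal:
  fixes d :: "nat \<Rightarrow> ('n, 'k::field) polynomials mat"
  assumes carrier: "\<And>i. d i \<in> carrier_mat (b i) (b (Suc i))"
    and exact: "\<And>i. mat_kernel (d i) = (\<lambda>w. d (Suc i) *\<^sub>v w) ` carrier_vec (b (Suc (Suc i)))"
    and "finite A" "card A \<le> i" "z \<in> carrier_vec (b (Suc i))"
    and "d i *\<^sub>v z \<in> var_ideal_vec A (b i)"
  shows "\<exists>v\<in>carrier_vec (b (Suc (Suc i))). \<exists>u\<in>var_ideal_vec A (b (Suc i)). z = d (Suc i) *\<^sub>v v + u"
  using assms(3-)
proof (induction A arbitrary: i z rule: finite_induct)
  case empty
  then have "z \<in> mat_kernel (d i)"
    using carrier[of i] by (auto simp: mat_kernel_def var_ideal_vec_empty)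
  then obtain v where v: "v \<in> carrier_vec (b (Suc (Suc i)))" "z = d (Suc i) *\<^sub>v v"
    unfolding exact by blast
  then have "z = d (Suc i) *\<^sub>v v + 0\<^sub>v (b (Suc i))"
    using empty.prems by simp
  with v(1) show ?case
    by (auto simp: var_ideal_vec_empty)
next
  case (insert x A)
  note [simp] = mult_mat_vec_carrier[OF carrier]
  have dd: "d j *\<^sub>v (d (Suc j) *\<^sub>v v) = 0\<^sub>v (b j)" if "v \<in> carrier_vec (b (Suc (Suc j)))" for j v
  proof -
    have "d (Suc j) *\<^sub>v v \<in> mat_kernel (d j)"
      unfolding exact using that by blast
    then show ?thesis
      using carrier[of j] by (simp add: mat_kernel_def)
  qed
  \<comment> \<open>Since \<open>A\<close> gains an element, \<open>i\<close> is positive and the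
    induction hypothesis is available at both \<open>i\<close> and \<open>j\<close>.\<close>
  obtain j where i: "i = Suc j" "card A \<le> j"
    using insert by (cases i) auto
  have z: "z \<in> carrier_vec (b (Suc i))" using insert by simp
  \<comment> \<open>The class of \<open>w\<close> modulo \<open>A\<close> is the image of
    \<open>z\<close> under the connecting map.\<close>
  obtain u w where u: "u \<in> var_ideal_vec A (b i)" and w: "w \<in> carrier_vec (b i)"
    and dz: "d i *\<^sub>v z = u + var x \<cdot>\<^sub>v w"
    using insert.prems(3) by (rule var_ideal_vec_insertE)
  have du: "d j *\<^sub>v u \<in> var_ideal_vec A (b j)"
    using mult_mat_var_ideal_vec[OF carrier] u i by simp
  \<comment> \<open>Applying the differential once more shows that \<open>x\<close> times the
    boundary of \<open>w\<close> vanishes modulo \<open>A\<close>; regularity of \<open>x\<close>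
    then makes \<open>w\<close> a cycle modulo \<open>A\<close>.\<close>
  have "0\<^sub>v (b j) = d j *\<^sub>v (u + var x \<cdot>\<^sub>v w)"
    using dd[of z j] z i dz by simp
  also have "\<dots> = d j *\<^sub>v u + var x \<cdot>\<^sub>v (d j *\<^sub>v w)"
    using u w i carrier[of j] var_ideal_vec_carrier[of u]
    by (simp add: mult_add_distrib_mat_vec[of _ "b j" "b (Suc j)"] mult_mat_vec_smult[of _ "b j" "b (Suc j)"])
  finally have "var x \<cdot>\<^sub>v (d j *\<^sub>v w) = - (d j *\<^sub>v u)"
    using w i var_ideal_vec_carrier[OF du] carrier[of j]
    by (auto simp: vec_eq_iff add_eq_0_iff)
  then have "var x \<cdot>\<^sub>v (d j *\<^sub>v w) \<in> var_ideal_vec A (b j)"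
    using du by (simp add: var_ideal_vec_uminus)
  then have "d j *\<^sub>v w \<in> var_ideal_vec A (b j)"
    using insert.hyps(2) w i var_regular_mod_var_ideal_vec[of x A "d j *\<^sub>v w" "b j"] by simp
  then obtain z' u' where z': "z' \<in> carrier_vec (b (Suc i))" and u': "u' \<in> var_ideal_vec A (b i)"
    and w_eq: "w = d i *\<^sub>v z' + u'"
    using insert.IH[of j w] i w by auto
  \<comment> \<open>Correcting \<open>z\<close> by \<open>x\<close> times the preimage
    \<open>z'\<close> of \<open>w\<close> gives a cycle modulo \<open>A\<close> itself, to which the
    hypothesis at \<open>i\<close> applies. The correction is absorbed by the larger ideal at the
    end.\<close>
  have "d i *\<^sub>v (z - var x \<cdot>\<^sub>v z') = d i *\<^sub>v z - var x \<cdot>\<^sub>v (d i *\<^sub>v z')"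
    using z z' carrier[of i]
    by (simp add: mult_minus_distrib_mat_vec[of _ "b i" "b (Suc i)"] mult_mat_vec_smult[of _ "b i" "b (Suc i)"])
  also have "\<dots> = u + var x \<cdot>\<^sub>v u'"
    unfolding dz w_eq using z' var_ideal_vec_carrier[OF u] var_ideal_vec_carrier[OF u'] carrier[of i]
    by (intro eq_vecI) (auto simp: algebra_simps)
  also have "\<dots> \<in> var_ideal_vec A (b i)"
    by (intro var_ideal_vec_add var_ideal_vec_smult u u')
  finally obtain v u'' where v: "v \<in> carrier_vec (b (Suc (Suc i)))"
    and u'': "u'' \<in> var_ideal_vec A (b (Suc i))" and eq: "z - var x \<cdot>\<^sub>v z' = d (Suc i) *\<^sub>v v + u''"
    using insert.IH[of i "z - var x \<cdot>\<^sub>v z'"] i z z' by auto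
  have "z = (z - var x \<cdot>\<^sub>v z') + var x \<cdot>\<^sub>v z'"
    using z z' by auto
  also have "\<dots> = d (Suc i) *\<^sub>v v + (u'' + var x \<cdot>\<^sub>v z')"
    unfolding eq using v z' var_ideal_vec_carrier[OF u'']
    by (simp add: assoc_add_vec[of _ "b (Suc i)"])
  finally have "z = d (Suc i) *\<^sub>v v + (u'' + var x \<cdot>\<^sub>v z')" .
  moreover have "u'' + var x \<cdot>\<^sub>v z' \<in> var_ideal_vec (insert x A) (b (Suc i))"
    using u'' z' var_ideal_vec_mono[of A "insert x A"]
    by (auto intro!: var_ideal_vec_add var_smult_in_var_ideal_vec)
  ultimately show ?case
    using v by blast
qed

lemma minimal_free_resolution_rank_eq_0:
  fixes M :: "('n::finite, 'k::field) polynomials set"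
  assumes "minimal_free_resolution M b \<delta> \<epsilon> d" "CARD('n) < i"
  shows "b i = 0"
proof (rule ccontr)
  assume "b i \<noteq> 0"
  \<comment> \<open>Exactness at the module of rank \<open>b i\<close> concerns the kernel of
    \<open>d j\<close> with \<open>i = Suc j\<close>, so the strict bound on \<open>i\<close> gives
    exactly the required \<open>CARD('n) \<le> j\<close>.\<close>
  obtain j where i: "i = Suc j" "CARD('n) \<le> j"
    using assms(2) by (cases i) auto
  have res: "multigraded_free_resolution M b \<delta> \<epsilon> d"
    and nonunit: "p < b l \<Longrightarrow> q < b (Suc l) \<Longrightarrow> \<not> d l $$ (p, q) dvd 1" for l p q
    using assms(1) by (auto simp: minimal_free_resolution_def)
  then have carrier: "d l \<in> carrier_mat (b l) (b (Suc l))"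
    and exact: "mat_kernel (d l) = (\<lambda>w. d (Suc l) *\<^sub>v w) ` carrier_vec (b (Suc (Suc l)))"
    and homogeneous: "p < b l \<Longrightarrow> q < b (Suc l) \<Longrightarrow>
      homogeneous (\<lambda>x. \<delta> (Suc l) q x - \<delta> l p x) (d l $$ (p, q))" for l p q
    by (simp_all add: multigraded_free_resolution_def)
  have entries: "d l $$ (p, q) \<in> var_ideal UNIV" if "p < b l" "q < b (Suc l)" for l p q
    using homogeneous[OF that] nonunit[OF that] by (rule homogeneous_nonunit_in_var_ideal)
  have im: "d l *\<^sub>v v \<in> var_ideal_vec UNIV (b l)" if "v \<in> carrier_vec (b (Suc l))" for l v
    using carrier entries that by (rule mult_var_ideal_mat_vec)
  let ?e = "unit_vec (b i) 0 :: ('n, 'k) polynomials vec"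
  \<comment> \<open>By \<open>im\<close>, the basis vector \<open>?e\<close> is a cycle modulo all
    variables, hence a boundary up to an error \<open>u\<close> in the ideal. The boundary lies in
    the ideal too, whereas \<open>?e\<close> has an entry \<open>1\<close>.\<close>
  obtain v u where "v \<in> carrier_vec (b (Suc i))" "u \<in> var_ideal_vec UNIV (b i)"
    "?e = d i *\<^sub>v v + u"
    using exact_mod_var_ideal[of d b UNIV j ?e, OF carrier exact] im[of ?e j] i by auto
  then have "?e \<in> var_ideal_vec UNIV (b i)"
    using im by (simp add: var_ideal_vec_add)
  then have "?e $ 0 \<in> var_ideal UNIV"
    using \<open>b i \<noteq> 0\<close> by (auto simp: var_ideal_vec_def)
  then show False
    using \<open>b i \<noteq> 0\<close> by (simp add: one_notin_var_ideal)
qed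

theorem theorem4p6:
  fixes M :: "('n::finite, 'k::field) polynomials set"
  assumes "monomial_ideal M"
  shows "proj_dim_quotient M \<le> enat CARD('n)"
  unfolding proj_dim_quotient_def
\<comment> \<open>The supremum ranges over all minimal resolutions, and the rank bound applies to
  each of them separately.\<close>
proof (rule SUP_least, clarify)
  fix i b \<delta> \<epsilon> d
  assume "minimal_free_resolution M b \<delta> \<epsilon> d" "0 < b i"
  then show "enat i \<le> enat CARD('n)"
    using minimal_free_resolution_rank_eq_0 by (metis enat_ord_simps(1) not_le less_irrefl)
qed

end
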